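(* Let $X$ be a proper complete metric space and $\Lambda$ a (nonempty) compact metric space. Let $p$ be a fair Borel probability measure on $\Lambda$ and $\mathbb P:=p^{\mathbb N}$ the product measure on $\Omega=\Lambda^{\mathbb N}$. Let $w:\Lambda\times X\to X$ be a continuous iterated function system with a global attractor $K$. Then for every $x\in X$, for $\mathbb P$-almost every $\sigma\in\Omega$ the orbit $x_0=x$, $x_k=w_{\sigma_k}(x_{k-1})$ ($k\ge1$) draws the attractor $K$, i.e. $K=\lim_{k\to\infty}\{x_n\}_{n=k}^{\infty}$ in the Hausdorff metric.
   Context: An iterated function system (IFS) is a continuous map $w:\Lambda\times X\to X$; put $w_\lambda(x):=w(\lambda,x)$. $\mathcal K(X)$ is the family of nonempty compact subsets of $X$, $d_H(A,B)=\sup\{d(a,B),d(b,A):a\in A,b\in B\}$ with $d(x,F)=\inf_{y\in F}d(x,y)$ (the same formula is used for arbitrary nonempty subsets), and $\mathcal F:\mathcal K(X)\to\mathcal K(X)$ is $\mathcal F(A)=\bigcup_{\lambda\in\Lambda}w_\lambda(A)$. A global attractor of $w$ is a set $K\in\mathcal K(X)$ such that $\mathcal F^n(B)\to K$ in the Hausdorff metric for every $B\in\mathcal K(X)$. A metric space is proper if every closed ball is compact. A Borel probability measure $p$ on $\Lambda$ is fair if there is a function $f:(0,+\infty)\to(0,1]$ such that $p(B(\lambda,\delta))\ge f(\delta)$ for every $\lambda\in\Lambda$ and every $\delta>0$. The convergence $K=\lim_{k\to\infty}\{x_n\}_{n=k}^\infty$ means $d_H(K,\{x_n:n\ge k\})\to0$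 as $k\to\infty$. *)

theory Defs
  imports "HOL-Probability.Probability"
begin

text \<open>
  Extended-valued, so that the supremum is a genuine one also for unbounded sets.
  Intended for nonempty arguments only, since \<^term>\<open>infdist x {} = 0\<close>.
\<close>
definition hausdorff_dist :: "'a::metric_space set \<Rightarrow> 'a set \<Rightarrow> ennreal" where
  "hausdorff_dist A B =
     Sup ({ennreal (infdist a B) | a. a \<in> A} \<union> {ennreal (infdist b A) | b. b \<in> B})"

definition hutchinson :: "('l \<times> 'x \<Rightarrow> 'x) \<Rightarrow> 'x set \<Rightarrow> 'x set" where
  "hutchinson w A = (\<Union>l. (\<lambda>x. w (l, x)) ` A)"

definition global_attractor :: "('l \<times> 'x \<Rightarrow> 'x) \<Rightarrow> 'x::metric_space set \<Rightarrow> bool" where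
  "global_attractor w K \<longleftrightarrow>
     compact K \<and> K \<noteq> {} \<and>
     (\<forall>B. compact B \<and> B \<noteq> {} \<longrightarrow>
        (\<lambda>n. hausdorff_dist ((hutchinson w ^^ n) B) K) \<longlonglongrightarrow> 0)"

definition fair_measure :: "'l::metric_space measure \<Rightarrow> bool" where
  "fair_measure p \<longleftrightarrow>
     (\<exists>f :: real \<Rightarrow> real. f ` {0<..} \<subseteq> {0<..1} \<and>
        (\<forall>l. \<forall>\<delta>>0. measure p (ball l \<delta>) \<ge> f \<delta>))"

text \<open>The driving sequence \<open>\<sigma>\<close> is indexed from 1; the value \<open>\<sigma> 0\<close> is never used.\<close>
primrec orbit :: "('l \<times> 'x \<Rightarrow> 'x) \<Rightarrow> (nat \<Rightarrow> 'l) \<Rightarrow> 'x \<Rightarrow> nat \<Rightarrow> 'x" where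
  "orbit w \<sigma> x 0 = x"
| "orbit w \<sigma> x (Suc k) = w (\<sigma> (Suc k), orbit w \<sigma> x k)"

end

theory Submission
  imports Defs
begin

text \<open>
  One half of the convergence holds for every driving sequence: the point \<open>x\<^sub>n\<close> lies in the
  \<open>n\<close>-th Hutchinson iterate of \<open>{x}\<close>, which tends to \<open>K\<close>, so \<open>x\<^sub>n\<close> approaches \<open>K\<close>. For the
  other half it suffices that, almost surely, the orbit enters every ball \<open>G\<close> of radius
  \<open>1/(i+1)\<close> centred at a point of a countable dense subset of \<open>K\<close> infinitely often
  (\<open>tendsto_hausdorff_tails\<close>). There are countably many such balls, so each may be treated
  separately.

  The set \<open>Y\<close> of all points reachable from \<open>x\<close> is forward invariant. It is also bounded, since all
  but finitely many Hutchinson iterates of \<open>{x}\<close> lie within distance 1 of \<open>K\<close> and the others are compact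
  (\<open>bounded_reachable_set\<close>); as \<open>X\<close> is proper, its closure is compact. From each point \<open>y\<close>
  of this closure some finite word leads into \<open>G\<close>, because the iterates of \<open>{y}\<close> converge to
  \<open>K\<close>. By continuity, all words close enough to that one lead into \<open>G\<close> from all points
  close enough to \<open>y\<close>, and fairness gives these words positive probability
  (\<open>uniform_hit_nearby\<close>). By compactness there is a single \<open>q > 0\<close> such that from every
  point of \<open>Y\<close> the chance to be in \<open>G\<close> at a suitable time is at least \<open>q\<close>
  (\<open>uniform_hit\<close>).

  Now let \<open>h y\<close> be the probability that the random orbit of \<open>y\<close> never meets \<open>G\<close>, and suppose
  \<open>h \<le> c\<close> on \<open>Y\<close>. Restarting the orbit at the suitable time for \<open>y\<close> shows that
  \<open>h y \<le> (1 - q) c\<close>. Iterating from \<open>c = 1\<close> gives \<open>h = 0\<close> on \<open>Y\<close> (\<open>miss_null\<close>), and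
  restarting the orbit at an arbitrary time \<open>N\<close> turns this into infinitely many visits
  (\<open>AE_run_recurrent\<close>).
\<close>

section \<open>Separability and measurability\<close>

text \<open>
  This supplies countable dense sets for the parameter space, for a proper space (the union of
  the closed balls around one point) and for the attractor: they are formed by the centres of finite
  covers of each \<open>C n\<close> by balls of radius \<open>1/(m+1)\<close>.
\<close>
lemma sigma_compact_imp_countable_dense:
  fixes C :: "nat \<Rightarrow> 'a::metric_space set"
  assumes C: "\<And>n. compact (C n)"
  shows "\<exists>D. countable D \<and> D \<subseteq> (\<Union>n. C n) \<and> (\<Union>n. C n) \<subseteq> closure D"
proof -
  have "\<exists>k. finite k \<and> k \<subseteq> C n \<and> C n \<subseteq> (\<Union>x\<in>k. ball x (1 / Suc m))" for n m
  proof -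
    obtain k where "k \<subseteq> C n" "finite k" "C n \<subseteq> (\<Union>x\<in>k. ball x (1 / Suc m))"
      by (rule compactE_image[OF C, of "C n" "\<lambda>x. ball x (1 / Suc m)" n]) auto
    then show ?thesis by blast
  qed
  then obtain k where k: "\<And>n m. finite (k n m)" "\<And>n m. k n m \<subseteq> C n" "\<And>n m. C n \<subseteq> (\<Union>x\<in>k n m. ball x (1 / Suc m))"
    by metis
  have "x \<in> closure (\<Union>n m. k n m)" if "x \<in> C n" for x n
  proof (subst closure_approachable, intro allI impI)
    fix e :: real assume "0 < e"
    then obtain m where m: "1 / Suc m < e"
      using nat_approx_posE by auto
    from that k(3)[of n m] obtain y where "y \<in> k n m" "dist y x < 1 / Suc m"
      by fastforce
    with m show "\<exists>y\<in>\<Union>n m. k n m. dist y x < e"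
      by (meson UN_I UNIV_I less_trans)
  qed
  moreover have "countable (\<Union>n m. k n m)"
    using k(1) by (intro countable_UN countableI_type countable_finite)
  moreover have "(\<Union>n m. k n m) \<subseteq> (\<Union>n. C n)"
    using k(2) by blast
  ultimately show ?thesis by blast
qed

text \<open>
  Every open set of a product of two separable metric spaces is a countable union of products
  of balls, so joint Borel measurability follows from that of the components. Without
  separability the Borel sets of the product may be too many for this.
\<close>
lemma borel_measurable_Pair_separable:
  fixes f :: "'m \<Rightarrow> 'a::metric_space" and g :: "'m \<Rightarrow> 'b::metric_space"
  assumes D: "countable D" "closure D = (UNIV :: 'a set)"
    and E: "countable E" "closure E = (UNIV :: 'b set)"
    and [measurable]: "f \<in> borel_measurable M" "g \<in> borel_measurable M"
  shows "(\<lambda>x. (f x, g x)) \<in> borel_measurable M"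
proof (rule borel_measurableI)
  fix U :: "('a \<times> 'b) set" assume U: "open U"
  define I where "I = {(d, e, n). d \<in> D \<and> e \<in> E \<and>
    ball d (1 / Suc n) \<times> ball e (1 / Suc n) \<subseteq> U}"
  have "I \<subseteq> D \<times> E \<times> (UNIV :: nat set)"
    by (auto simp: I_def)
  then have cI: "countable I"
    using D(1) E(1) by (meson countable_SIGMA countable_subset countableI_type)
  have in_I: "\<exists>(d, e, n)\<in>I. a \<in> ball d (1 / Suc n) \<and> b \<in> ball e (1 / Suc n)"
    if "(a, b) \<in> U" for a b
  proof -
    from U that obtain A B where AB: "open A" "open B" "a \<in> A" "b \<in> B" "A \<times> B \<subseteq> U"
      by (auto elim!: open_prod_elim)
    then obtain r s where rs: "r > 0" "s > 0" "ball a r \<subseteq> A" "ball b s \<subseteq> B"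
      by (meson open_contains_ball)
    \<comment> \<open>Half the radius: a ball of this radius around a point this close to \<open>a\<close> stays in \<open>ball a r\<close>.\<close>
    obtain n where n: "1 / real (Suc n) < min r s / 2"
      using nat_approx_posE[of "min r s / 2"] rs by auto
    obtain d where d: "d \<in> D" "dist d a < 1 / Suc n"
      using D(2) by (metis UNIV_I closure_approachable of_nat_0_less_iff zero_less_Suc zero_less_divide_1_iff)
    obtain e where e: "e \<in> E" "dist e b < 1 / Suc n"
      using E(2) by (metis UNIV_I closure_approachable of_nat_0_less_iff zero_less_Suc zero_less_divide_1_iff)
    have "ball d (1 / Suc n) \<subseteq> ball a r"
    proof
      fix z assume "z \<in> ball d (1 / Suc n)"
      then have "dist a z < 2 * (1 / Suc n)"
        using d(2) dist_triangle[of a z d] by (simp add: dist_commute)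
      then show "z \<in> ball a r" using n by simp
    qed
    moreover have "ball e (1 / Suc n) \<subseteq> ball b s"
    proof
      fix z assume "z \<in> ball e (1 / Suc n)"
      then have "dist b z < 2 * (1 / Suc n)"
        using e(2) dist_triangle[of b z e] by (simp add: dist_commute)
      then show "z \<in> ball b s" using n by simp
    qed
    ultimately have "ball d (1 / Suc n) \<times> ball e (1 / Suc n) \<subseteq> U"
      using rs AB(5) by blast
    with d e show ?thesis
      by (intro bexI[of _ "(d, e, n)"]) (auto simp: I_def)
  qed
  have "(\<lambda>x. (f x, g x)) -` U \<inter> space M =
    (\<Union>(d, e, n)\<in>I. {x \<in> space M. f x \<in> ball d (1 / Suc n) \<and> g x \<in> ball e (1 / Suc n)})"
    (is "?L = ?R")
  proof
    show "?L \<subseteq> ?R"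
    proof
      fix x assume x: "x \<in> ?L"
      with in_I[of "f x" "g x"] obtain d e n
        where "(d, e, n) \<in> I" "f x \<in> ball d (1 / Suc n)" "g x \<in> ball e (1 / Suc n)"
        by auto
      with x show "x \<in> ?R" by blast
    qed
    show "?R \<subseteq> ?L" unfolding I_def by blast
  qed
  also have "\<dots> \<in> sets M"
  proof (rule sets.countable_UN'[OF cI], clarify)
    fix d e n
    have "{x \<in> space M. f x \<in> ball d r \<and> g x \<in> ball e r} =
        (f -` ball d r \<inter> space M) \<inter> (g -` ball e r \<inter> space M)" for r
      by auto
    also have "\<dots> r \<in> sets M" for r
      by (intro sets.Int measurable_sets[OF _ borel_open]) auto
    finally show "{x \<in> space M. f x \<in> ball d (1 / Suc n) \<and> g x \<in> ball e (1 / Suc n)} \<in> sets M" .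
  qed
  finally show "(\<lambda>x. (f x, g x)) -` U \<inter> space M \<in> sets M" .
qed

section \<open>Random orbits\<close>

text \<open>
  The orbit of \<open>y\<close> under a driving sequence indexed from 0, so that \<^const>\<open>comb_seq\<close>
  prepends \<open>n\<close> steps to a driving sequence without a change of indices.
\<close>
primrec run :: "('l \<times> 'x \<Rightarrow> 'x) \<Rightarrow> (nat \<Rightarrow> 'l) \<Rightarrow> 'x \<Rightarrow> nat \<Rightarrow> 'x" where
  "run w \<omega> y 0 = y"
| "run w \<omega> y (Suc n) = w (\<omega> n, run w \<omega> y n)"

lemma orbit_eq_run: "orbit w \<sigma> y n = run w (\<lambda>i. \<sigma> (Suc i)) y n"
  by (induction n) auto

lemma run_comb_seq_less: "k \<le> n \<Longrightarrow> run w (comb_seq n \<omega> \<omega>') y k = run w \<omega> y k"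
  by (induction k) (auto simp: comb_seq_less)

text \<open>
  The deterministic part of the Markov property: after the first \<open>n\<close> steps the orbit starts
  afresh from where it is, driven by the second sequence.
\<close>
lemma run_comb_seq_add:
  "run w (comb_seq n \<omega> \<omega>') y (n + k) = run w \<omega>' (run w \<omega> y n) k"
proof (induction k)
  case 0
  show ?case by (simp add: run_comb_seq_less)
next
  case (Suc k)
  then show ?case by (simp add: comb_seq_def)
qed

lemma run_in_hutchinson_funpow: "run w \<omega> y n \<in> (hutchinson w ^^ n) {y}"
  by (induction n) (auto simp: hutchinson_def)

text \<open>
  Splitting off the first map rather than the last one is what an induction over the
  starting point needs.
\<close>
lemma hutchinson_funpow_Suc_singleton:
  "(hutchinson w ^^ Suc n) {y} = (\<Union>l. (hutchinson w ^^ n) {w (l, y)})"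
proof (induction n)
  case 0
  show ?case by (auto simp: hutchinson_def)
next
  case (Suc n)
  have "(hutchinson w ^^ Suc (Suc n)) {y} = hutchinson w ((hutchinson w ^^ Suc n) {y})"
    by simp
  also have "\<dots> = (\<Union>l. hutchinson w ((hutchinson w ^^ n) {w (l, y)}))"
    unfolding Suc.IH by (auto simp: hutchinson_def)
  finally show ?case by simp
qed

locale random_ifs = sequence_space p
  for p :: "'l::metric_space measure" +
  fixes w :: "'l \<times> 'x::metric_space \<Rightarrow> 'x"
  assumes sets_p: "sets p = sets borel"
    and cont: "continuous_on UNIV w"
    and sep_l: "\<exists>D::'l set. countable D \<and> closure D = UNIV"
    and sep_x: "\<exists>D::'x set. countable D \<and> closure D = UNIV"
begin

lemma space_p: "space p = UNIV"
  using sets_eq_imp_space_eq[OF sets_p] by simp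

lemma space_S: "space S = UNIV"
  by (simp add: space_PiM space_p)

lemma measurable_run [measurable]: "(\<lambda>\<omega>. run w \<omega> y n) \<in> S \<rightarrow>\<^sub>M borel"
proof (induction n)
  case (Suc n)
  have [measurable]: "(\<lambda>\<omega>. \<omega> n) \<in> S \<rightarrow>\<^sub>M borel"
    using measurable_component_singleton[of n UNIV "\<lambda>_. p"] measurable_cong_sets[OF refl sets_p, of S]
    by (metis UNIV_I)
  obtain D :: "'l set" and E :: "'x set" where "countable D" "closure D = UNIV" "countable E" "closure E = UNIV"
    using sep_l sep_x by metis
  from borel_measurable_Pair_separable[OF this \<open>(\<lambda>\<omega>. \<omega> n) \<in> _\<close> Suc.IH]
  have "(\<lambda>\<omega>. (\<omega> n, run w \<omega> y n)) \<in> S \<rightarrow>\<^sub>M borel" .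
  from measurable_compose[OF this borel_measurable_continuous_onI[OF cont]]
  show ?case by simp
qed simp

lemma sets_run [measurable]: "A \<in> sets borel \<Longrightarrow> {\<omega>. run w \<omega> y n \<in> A} \<in> sets S"
  using measurable_sets[OF measurable_run, of A y n] by (simp add: space_S vimage_def)

text \<open>
  The probabilistic part of the Markov property. The first \<open>n\<close> coordinates are independent of the
  remaining ones, and the latter are again distributed as the whole sequence; hence the
  first \<open>n\<close> may be frozen and the rest integrated first.
\<close>
lemma emeasure_comb_seq:
  assumes E: "E \<in> sets S"
  shows "emeasure S E = (\<integral>\<^sup>+\<omega>. emeasure S {\<omega>'. comb_seq n \<omega> \<omega>' \<in> E} \<partial>S)"
proof -
  have "emeasure S E = emeasure (distr (S \<Otimes>\<^sub>M S) S (\<lambda>(\<omega>, \<omega>'). comb_seq n \<omega> \<omega>')) E"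
    by (simp only: PiM_comb_seq)
  also have "\<dots> = emeasure (S \<Otimes>\<^sub>M S) ((\<lambda>(\<omega>, \<omega>'). comb_seq n \<omega> \<omega>') -` E \<inter> space (S \<Otimes>\<^sub>M S))"
    by (rule emeasure_distr[OF measurable_comb_seq E])
  also have "\<dots> = (\<integral>\<^sup>+\<omega>. emeasure S (Pair \<omega> -` ((\<lambda>(\<omega>, \<omega>'). comb_seq n \<omega> \<omega>') -` E \<inter> space (S \<Otimes>\<^sub>M S))) \<partial>S)"
    by (rule P.emeasure_pair_measure_alt[OF measurable_sets[OF measurable_comb_seq E]])
  also have "\<dots> = (\<integral>\<^sup>+\<omega>. emeasure S {\<omega>'. comb_seq n \<omega> \<omega>' \<in> E} \<partial>S)"
    by (simp add: space_pair_measure space_S vimage_def)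
  finally show ?thesis .
qed

lemma emeasure_first_step:
  assumes "A \<in> sets p"
  shows "emeasure S {\<omega>. \<omega> 0 \<in> A} = emeasure p A"
proof -
  have "emeasure p A = emeasure (distr S p (\<lambda>\<omega>. \<omega> 0)) A"
    by (simp add: PiM_component)
  also have "\<dots> = emeasure S {\<omega>. \<omega> 0 \<in> A}"
    using assms by (subst emeasure_distr) (auto simp: space_S vimage_def)
  finally show ?thesis ..
qed

text \<open>
  If \<open>z\<close> is reached from \<open>y\<close> by a word whose first letter is \<open>l\<close>, then \<open>w (l, y)\<close> has by
  induction a neighbourhood \<open>V\<close> with the required lower bound \<open>q\<close>. By continuity all letters
  \<open>\<delta>\<close>-close to \<open>l\<close> send a neighbourhood of \<open>y\<close> into \<open>V\<close>, so there the bound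
  \<open>q\<close> times the measure of the \<open>\<delta>\<close>-ball works.
\<close>
lemma uniform_hit_nearby:
  assumes fair: "\<And>l \<delta>. \<delta> > 0 \<Longrightarrow> measure p (ball l \<delta>) > 0"
    and G: "open G" and z: "z \<in> (hutchinson w ^^ n) {y}" "z \<in> G"
  shows "\<exists>V q. open V \<and> y \<in> V \<and> 0 < q \<and> (\<forall>y'\<in>V. q \<le> measure S {\<omega>. run w \<omega> y' n \<in> G})"
  using z(1)
proof (induction n arbitrary: y)
  case 0
  have "measure S UNIV = 1"
    using P.prob_space by (simp add: space_S)
  with 0 z(2) G show ?case
    by (intro exI[of _ G] exI[of _ 1]) auto
next
  case (Suc n)
  then obtain l where "z \<in> (hutchinson w ^^ n) {w (l, y)}"
    unfolding hutchinson_funpow_Suc_singleton by blast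
  from Suc.IH[OF this] obtain V q where V: "open V" "w (l, y) \<in> V" and q: "0 < q"
    and Vq: "\<And>y'. y' \<in> V \<Longrightarrow> q \<le> measure S {\<omega>. run w \<omega> y' n \<in> G}"
    by blast
  have "open (w -` V)"
    using cont V(1) by (simp add: open_vimage)
  moreover have "(l, y) \<in> w -` V" using V by simp
  ultimately obtain A B where AB: "open A" "open B" "l \<in> A" "y \<in> B" "A \<times> B \<subseteq> w -` V"
    by (auto elim!: open_prod_elim)
  then obtain \<delta> where \<delta>: "\<delta> > 0" "ball l \<delta> \<subseteq> A"
    by (meson open_contains_ball)
  have [measurable]: "ball l \<delta> \<in> sets p" by (simp add: sets_p)
  have "q * measure p (ball l \<delta>) \<le> measure S {\<omega>. run w \<omega> y' (Suc n) \<in> G}" if y': "y' \<in> B" for y'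
  proof -
    have "ennreal (q * measure p (ball l \<delta>)) = ennreal q * emeasure S {\<omega>. \<omega> 0 \<in> ball l \<delta>}"
      using q by (subst emeasure_first_step) (auto simp: ennreal_mult M.emeasure_eq_measure)
    also have "\<dots> = (\<integral>\<^sup>+\<omega>. ennreal q * indicator {\<omega>. \<omega> 0 \<in> ball l \<delta>} \<omega> \<partial>S)"
    proof (rule nn_integral_cmult_indicator[symmetric])
      have "(\<lambda>\<omega>. \<omega> 0) -` ball l \<delta> \<inter> space S \<in> sets S"
        by (rule measurable_sets[OF measurable_component_singleton]) (auto simp: sets_p)
      then show "{\<omega>. \<omega> 0 \<in> ball l \<delta>} \<in> sets S" by (simp add: space_S vimage_def)
    qed
    also have "\<dots> \<le> (\<integral>\<^sup>+\<omega>. emeasure S {\<omega>'. comb_seq 1 \<omega> \<omega>' \<in> {\<omega>. run w \<omega> y' (Suc n) \<in> G}} \<partial>S)"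
    proof (rule nn_integral_mono)
      fix \<omega>
      have "run w (comb_seq 1 \<omega> \<omega>') y' (Suc n) = run w \<omega>' (w (\<omega> 0, y')) n" for \<omega>'
        using run_comb_seq_add[of w 1 \<omega> \<omega>' y' n] by simp
      moreover have "ennreal q \<le> emeasure S {\<omega>'. run w \<omega>' (w (\<omega> 0, y')) n \<in> G}"
        if "\<omega> 0 \<in> ball l \<delta>"
      proof -
        have "w (\<omega> 0, y') \<in> V" using that \<delta> AB y' by blast
        then show ?thesis using Vq by (simp add: P.emeasure_eq_measure)
      qed
      ultimately show "ennreal q * indicator {\<omega>. \<omega> 0 \<in> ball l \<delta>} \<omega>
          \<le> emeasure S {\<omega>'. comb_seq 1 \<omega> \<omega>' \<in> {\<omega>. run w \<omega> y' (Suc n) \<in> G}}"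
        by (auto simp: indicator_def)
    qed
    also have "\<dots> = emeasure S {\<omega>. run w \<omega> y' (Suc n) \<in> G}"
      by (rule emeasure_comb_seq[symmetric]) (use G in measurable)
    finally show ?thesis
      by (simp add: P.emeasure_eq_measure)
  qed
  then show ?case
    using AB(2,4) q fair[OF \<delta>(1), of l]
    by (intro exI[of _ B] exI[of _ "q * measure p (ball l \<delta>)"]) auto
qed

text \<open>
  A finite subcover turns the local bounds into one bound \<open>q\<close>. The hitting time may still depend on
  the point: the renewal argument in \<open>miss_null\<close> restarts at that time, whatever it is.
\<close>
lemma uniform_hit:
  assumes fair: "\<And>l \<delta>. \<delta> > 0 \<Longrightarrow> measure p (ball l \<delta>) > 0"
    and G: "open G" and C: "compact C"
    and reach: "\<And>y. y \<in> C \<Longrightarrow> \<exists>n. (hutchinson w ^^ n) {y} \<inter> G \<noteq> {}"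
  shows "\<exists>q>0. \<forall>y\<in>C. \<exists>n. q \<le> measure S {\<omega>. run w \<omega> y n \<in> G}"
proof -
  have "\<exists>V q. open V \<and> y \<in> V \<and> 0 < q \<and> (\<forall>y'\<in>V. \<exists>n. q \<le> measure S {\<omega>. run w \<omega> y' n \<in> G})"
    if "y \<in> C" for y
  proof -
    from reach[OF that] obtain n z where "z \<in> (hutchinson w ^^ n) {y}" "z \<in> G" by blast
    from uniform_hit_nearby[OF fair G this] show ?thesis by meson
  qed
  then obtain V q where V: "\<And>y. y \<in> C \<Longrightarrow> open (V y) \<and> y \<in> V y" and q: "\<And>y. y \<in> C \<Longrightarrow> 0 < q y"
    and Vq: "\<And>y y'. \<lbrakk>y \<in> C; y' \<in> V y\<rbrakk> \<Longrightarrow> \<exists>n. q y \<le> measure S {\<omega>. run w \<omega> y' n \<in> G}"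
    by metis
  obtain T where T: "T \<subseteq> C" "finite T" "C \<subseteq> (\<Union>y\<in>T. V y)"
    by (rule compactE_image[OF C, of C V]) (use V in auto)
  \<comment> \<open>The 1 is inserted to cover the case of an empty \<open>C\<close>.\<close>
  have "0 < Min (insert 1 (q ` T))"
    using T q by (auto simp: subset_iff)
  moreover have "\<exists>n. Min (insert 1 (q ` T)) \<le> measure S {\<omega>. run w \<omega> y n \<in> G}" if "y \<in> C" for y
  proof -
    from that T obtain t where t: "t \<in> T" "y \<in> V t" by blast
    with T obtain n where "q t \<le> measure S {\<omega>. run w \<omega> y n \<in> G}"
      using Vq by blast
    moreover have "Min (insert 1 (q ` T)) \<le> q t"
      using t T by auto
    ultimately show ?thesis by (meson order_trans)
  qed
  ultimately show ?thesis by blast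
qed

lemma sets_miss [measurable]:
  "G \<in> sets borel \<Longrightarrow> {\<omega>. \<forall>k\<ge>N. run w \<omega> y k \<notin> G} \<in> sets S"
proof -
  assume G: "G \<in> sets borel"
  have "{\<omega>. \<forall>k\<ge>N. run w \<omega> y k \<notin> G} = (\<Inter>k\<in>{N..}. {\<omega>. run w \<omega> y k \<in> - G})"
    by auto
  also have "\<dots> \<in> sets S"
    using G by (intro sets.countable_INT) (blast intro: sets_run borel_comp)+
  finally show ?thesis .
qed

text \<open>
  An orbit that never meets \<open>G\<close> must avoid \<open>G\<close> at the time \<open>n\<close> attached to its starting
  point, which has probability at most \<open>1 - q\<close>, and afterwards the orbit restarted at time
  \<open>n\<close>, still within \<open>Y\<close>, must never meet \<open>G\<close>. So any upper bound valid on the whole of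
  \<open>Y\<close> improves by the factor \<open>1 - q\<close>.
\<close>
lemma miss_null:
  assumes G: "G \<in> sets borel"
    and inv: "\<And>l y. y \<in> Y \<Longrightarrow> w (l, y) \<in> Y"
    and q: "0 < q" and hit: "\<And>y. y \<in> Y \<Longrightarrow> \<exists>n. q \<le> measure S {\<omega>. run w \<omega> y n \<in> G}"
    and y: "y \<in> Y"
  shows "emeasure S {\<omega>. \<forall>k. run w \<omega> y k \<notin> G} = 0"
proof -
  define h where "h y = emeasure S {\<omega>. \<forall>k. run w \<omega> y k \<notin> G}" for y
  have run_Y: "run w \<omega> y n \<in> Y" if "y \<in> Y" for \<omega> y n
    using that by (induction n) (auto intro: inv)
  have q1: "q \<le> 1"
    using hit[OF y] P.prob_le_1 order_trans by blast
  have step: "h y \<le> c * ennreal (1 - q)" if c: "\<And>y. y \<in> Y \<Longrightarrow> h y \<le> c" and y: "y \<in> Y" for c y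
  proof -
    obtain n where n: "q \<le> measure S {\<omega>. run w \<omega> y n \<in> G}" using hit[OF y] by blast
    let ?A = "{\<omega>. run w \<omega> y n \<in> - G}"
    have A: "?A \<in> sets S" using G by (intro sets_run) auto
    have "h y = (\<integral>\<^sup>+\<omega>. emeasure S {\<omega>'. comb_seq n \<omega> \<omega>' \<in> {\<omega>. \<forall>k. run w \<omega> y k \<notin> G}} \<partial>S)"
      unfolding h_def using sets_miss[OF G, of 0 y] by (intro emeasure_comb_seq) simp
    also have "\<dots> \<le> (\<integral>\<^sup>+\<omega>. c * indicator ?A \<omega> \<partial>S)"
    proof (rule nn_integral_mono)
      fix \<omega>
      have sub: "{\<omega>'. comb_seq n \<omega> \<omega>' \<in> {\<omega>. \<forall>k. run w \<omega> y k \<notin> G}}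
          \<subseteq> {\<omega>'. \<forall>k. run w \<omega>' (run w \<omega> y n) k \<notin> G}" (is "?L \<subseteq> ?R")
        using run_comb_seq_add[of w n \<omega> _ y] by (auto simp del: comb_seq_Suc_0) metis
      show "emeasure S ?L \<le> c * indicator ?A \<omega>"
      proof (cases "\<omega> \<in> ?A")
        case True
        have "emeasure S ?L \<le> emeasure S ?R"
          using sets_miss[OF G, of 0 "run w \<omega> y n"] by (intro emeasure_mono sub) simp
        also have "\<dots> \<le> c" using c[OF run_Y[OF y]] by (simp add: h_def)
        finally show ?thesis using True by simp
      next
        case False
        then have "run w (comb_seq n \<omega> \<omega>') y n \<in> G" for \<omega>'
          by (simp add: run_comb_seq_less)
        then have "?L = {}" by blast
        then show ?thesis by (simp only: emeasure_empty zero_le)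
      qed
    qed
    also have "\<dots> = c * emeasure S ?A" using A by (rule nn_integral_cmult_indicator)
    also have "emeasure S ?A = ennreal (1 - measure S {\<omega>. run w \<omega> y n \<in> G})"
    proof -
      have "?A = space S - {\<omega>. run w \<omega> y n \<in> G}" by (auto simp: space_S)
      then show ?thesis
        using P.prob_compl[OF sets_run[OF G]] by (simp add: P.emeasure_eq_measure)
    qed
    also have "c * \<dots> \<le> c * ennreal (1 - q)"
      using n by (intro mult_left_mono ennreal_leI) auto
    finally show ?thesis .
  qed
  have "h y \<le> ennreal (1 - q) ^ j" if "y \<in> Y" for j y
    using that
  proof (induction j arbitrary: y)
    case 0
    show ?case by (simp add: h_def P.measure_le_1)
  next
    case (Suc j)
    then show ?case using step[of "ennreal (1 - q) ^ j" y] by (simp add: mult.commute)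
  qed
  then have "h y \<le> ennreal ((1 - q) ^ j)" for j
    using y q1 by (simp add: ennreal_power)
  moreover have "(\<lambda>j. ennreal ((1 - q) ^ j)) \<longlonglongrightarrow> ennreal 0"
    using q q1 by (intro tendsto_ennrealI LIMSEQ_power_zero) auto
  ultimately have "h y \<le> 0"
    by (intro LIMSEQ_le_const) (auto simp: ennreal_0)
  then show ?thesis by (simp add: h_def)
qed

text \<open>
  Missing \<open>G\<close> from time \<open>N\<close> on means that the orbit restarted at time \<open>N\<close> never meets \<open>G\<close>,
  and it restarts at a point of \<open>Y\<close>.
\<close>
lemma AE_run_recurrent:
  assumes G: "G \<in> sets borel"
    and inv: "\<And>l y. y \<in> Y \<Longrightarrow> w (l, y) \<in> Y"
    and q: "0 < q" and hit: "\<And>y. y \<in> Y \<Longrightarrow> \<exists>n. q \<le> measure S {\<omega>. run w \<omega> y n \<in> G}"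
    and y: "y \<in> Y"
  shows "AE \<omega> in S. \<forall>N. \<exists>k\<ge>N. run w \<omega> y k \<in> G"
proof (subst AE_all_countable, rule allI)
  fix N
  let ?E = "{\<omega>. \<forall>k\<ge>N. run w \<omega> y k \<notin> G}"
  have run_Y: "run w \<omega> y n \<in> Y" for \<omega> n
    using y by (induction n) (auto intro: inv)
  have E: "?E \<in> sets S" using G by (rule sets_miss)
  have "emeasure S ?E = (\<integral>\<^sup>+\<omega>. emeasure S {\<omega>'. comb_seq N \<omega> \<omega>' \<in> ?E} \<partial>S)"
    by (rule emeasure_comb_seq[OF E])
  also have "\<dots> = (\<integral>\<^sup>+\<omega>. 0 \<partial>S)"
  proof (rule nn_integral_cong)
    fix \<omega>
    have "{\<omega>'. comb_seq N \<omega> \<omega>' \<in> ?E} = {\<omega>'. \<forall>k. run w \<omega>' (run w \<omega> y N) k \<notin> G}"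
      by (auto simp: run_comb_seq_add le_iff_add)
    then show "emeasure S {\<omega>'. comb_seq N \<omega> \<omega>' \<in> ?E} = 0"
      using miss_null[OF G inv q hit run_Y] by simp
  qed
  finally have "emeasure S ?E = 0" by simp
  with E show "AE \<omega> in S. \<exists>k\<ge>N. run w \<omega> y k \<in> G"
    by (intro AE_I[of _ _ ?E]) (auto simp: not_less)
qed

end

section \<open>Hausdorff distance\<close>

lemma infdist_le_hausdorff_dist:
  "a \<in> A \<Longrightarrow> ennreal (infdist a B) \<le> hausdorff_dist A B"
  "b \<in> B \<Longrightarrow> ennreal (infdist b A) \<le> hausdorff_dist A B"
  unfolding hausdorff_dist_def by (auto intro!: Sup_upper)

lemma hausdorff_dist_le:
  assumes "\<And>a. a \<in> A \<Longrightarrow> infdist a B \<le> e" "\<And>b. b \<in> B \<Longrightarrow> infdist b A \<le> e"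
  shows "hausdorff_dist A B \<le> ennreal e"
  unfolding hausdorff_dist_def using assms by (auto intro!: Sup_least ennreal_leI)

lemma eventually_infdist_less:
  assumes lim: "(\<lambda>n. hausdorff_dist (A n) K) \<longlonglongrightarrow> 0" and e: "e > 0"
  shows "eventually (\<lambda>n. (\<forall>a\<in>A n. infdist a K < e) \<and> (\<forall>b\<in>K. infdist b (A n) < e)) sequentially"
proof -
  have "eventually (\<lambda>n. hausdorff_dist (A n) K < ennreal e) sequentially"
    using lim e by (auto intro: order_tendstoD)
  then show ?thesis
  proof eventually_elim
    case (elim n)
    have "infdist a B < e" if "ennreal (infdist a B) \<le> hausdorff_dist (A n) K" for a and B :: "'a set"
      using le_less_trans[OF that elim] by (simp add: ennreal_less_iff infdist_nonneg)
    then show ?case using infdist_le_hausdorff_dist[of _ "A n" K] infdist_le_hausdorff_dist(2)[of _ K "A n"] by blast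
  qed
qed

lemma infdist_lessE:
  assumes "infdist a A < e" "A \<noteq> {}"
  obtains z where "z \<in> A" "dist a z < e"
  using assms by (auto simp: infdist_notempty cINF_less_iff)

lemma tendsto_zero_ennrealI:
  fixes f :: "nat \<Rightarrow> ennreal"
  assumes "\<And>e::real. e > 0 \<Longrightarrow> eventually (\<lambda>n. f n \<le> ennreal e) sequentially"
  shows "f \<longlonglongrightarrow> 0"
proof (rule order_tendstoI)
  fix a :: ennreal assume "0 < a"
  then obtain r :: real where "0 < r" "ennreal r < a"
    by (metis dense ennreal_cases ennreal_less_zero_iff top.not_eq_extremum order_less_le_trans top_greatest)
  with assms[of r] show "eventually (\<lambda>n. f n < a) sequentially"
    by (auto elim!: eventually_mono)
qed simp

text \<open>
  The quantity \<open>infdist a {s n | n. n \<ge> k}\<close> is controlled for every \<open>k\<close>, since infinitely many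
  \<open>s n\<close> come close to a point of \<open>D\<close> near \<open>a\<close>; only the other half of the distance
  requires \<open>k\<close> to be large.
\<close>
lemma tendsto_hausdorff_tails:
  fixes s :: "nat \<Rightarrow> 'x::metric_space"
  assumes near: "\<And>e. e > 0 \<Longrightarrow> eventually (\<lambda>n. infdist (s n) K \<le> e) sequentially"
    and D: "K \<subseteq> closure D"
    and visit: "\<And>d (i::nat) N. d \<in> D \<Longrightarrow> \<exists>k\<ge>N. s k \<in> ball d (1 / Suc i)"
  shows "(\<lambda>k. hausdorff_dist K {s n | n. n \<ge> k}) \<longlonglongrightarrow> 0"
proof (rule tendsto_zero_ennrealI)
  fix e :: real assume e: "e > 0"
  obtain N where N: "\<And>n. n \<ge> N \<Longrightarrow> infdist (s n) K \<le> e"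
    using near[OF e] by (auto simp: eventually_sequentially)
  obtain i where i: "1 / Suc i < e / 2"
    using nat_approx_posE[of "e / 2"] e by auto
  have "hausdorff_dist K {s n | n. n \<ge> k} \<le> ennreal e" if k: "k \<ge> N" for k
  proof (rule hausdorff_dist_le)
    fix a assume "a \<in> K"
    with D e obtain d where d: "d \<in> D" "dist d a < e / 2"
      by (meson closure_approachable half_gt_zero subsetD)
    obtain n where n: "n \<ge> k" "s n \<in> ball d (1 / Suc i)"
      using visit[OF d(1)] by blast
    have "dist a (s n) \<le> e"
      using dist_triangle[of a "s n" d] d(2) n(2) i by (simp add: dist_commute)
    then show "infdist a {s n | n. n \<ge> k} \<le> e"
      using n(1) by (intro infdist_le2[of "s n"]) auto
  next
    fix b assume "b \<in> {s n | n. n \<ge> k}"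
    then show "infdist b K \<le> e" using N k by auto
  qed
  then show "eventually (\<lambda>k. hausdorff_dist K {s n | n. n \<ge> k} \<le> ennreal e) sequentially"
    by (auto simp: eventually_sequentially)
qed

section \<open>Orbits draw the attractor\<close>

lemma compact_hutchinson_funpow:
  fixes w :: "'l::metric_space \<times> 'x::metric_space \<Rightarrow> 'x"
  assumes "compact (UNIV :: 'l set)" "continuous_on UNIV w" "compact A"
  shows "compact ((hutchinson w ^^ n) A)"
proof (induction n)
  case (Suc n)
  have "hutchinson w B = w ` (UNIV \<times> B)" for B
    by (auto simp: hutchinson_def)
  moreover have "compact (w ` (UNIV \<times> (hutchinson w ^^ n) A))"
    using assms Suc by (intro compact_continuous_image compact_Times) (auto intro: continuous_on_subset)
  ultimately show ?case by (metis comp_apply funpow.simps(2))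
qed (use assms in simp)

text \<open>
  Only finitely many iterates fail to lie in the 1-neighbourhood of \<open>K\<close>, and each of these is
  compact.
\<close>
lemma bounded_reachable_set:
  fixes w :: "'l::metric_space \<times> 'x::metric_space \<Rightarrow> 'x"
  assumes params: "compact (UNIV :: 'l set)" and cont: "continuous_on UNIV w"
    and attractor: "global_attractor w K"
  shows "bounded (\<Union>n. (hutchinson w ^^ n) {x})"
proof -
  have K: "compact K" "K \<noteq> {}" "(\<lambda>n. hausdorff_dist ((hutchinson w ^^ n) {x}) K) \<longlonglongrightarrow> 0"
    using attractor by (auto simp: global_attractor_def)
  from eventually_infdist_less[OF K(3) zero_less_one] obtain N where
    N: "\<And>n a. n \<ge> N \<Longrightarrow> a \<in> (hutchinson w ^^ n) {x} \<Longrightarrow> infdist a K < 1"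
    by (auto simp: eventually_sequentially)
  obtain c r where cr: "K \<subseteq> cball c r"
    using K(1) compact_imp_bounded bounded_subset_cball by blast
  have "(\<Union>n. (hutchinson w ^^ n) {x}) \<subseteq> (\<Union>n<N. (hutchinson w ^^ n) {x}) \<union> cball c (r + 1)"
  proof
    fix z assume "z \<in> (\<Union>n. (hutchinson w ^^ n) {x})"
    then obtain n where n: "z \<in> (hutchinson w ^^ n) {x}" by blast
    show "z \<in> (\<Union>n<N. (hutchinson w ^^ n) {x}) \<union> cball c (r + 1)"
    proof (cases "n < N")
      case False
      then have "infdist z K < 1" using N[OF _ n] by simp
      then obtain b where "b \<in> K" "dist z b < 1"
        using K(2) infdist_lessE by metis
      then have "dist c z \<le> r + 1"
        using cr dist_triangle[of c z b] by (force simp: dist_commute)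
      then show ?thesis by simp
    qed (use n in auto)
  qed
  moreover have "bounded (\<Union>n<N. (hutchinson w ^^ n) {x})"
    using compact_hutchinson_funpow[OF params cont, of "{x}"]
    by (intro bounded_UN) (auto intro: compact_imp_bounded)
  ultimately show ?thesis
    by (meson bounded_Un bounded_cball bounded_subset)
qed

theorem theorem6:
  fixes w :: "'l::metric_space \<times> 'x::complete_space \<Rightarrow> 'x"
    and p :: "'l measure"
    and K :: "'x set"
    and x :: 'x
  assumes proper: "\<And>(a::'x) r. compact (cball a r)"
    and compact_params: "compact (UNIV :: 'l set)"
    and borel: "sets p = sets borel"
    and prob: "prob_space p"
    and fair: "fair_measure p"
    and cont: "continuous_on UNIV w"
    and attractor: "global_attractor w K"
  shows "AE \<sigma> in (\<Pi>\<^sub>M i\<in>{1::nat..}. p).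
           (\<lambda>k. hausdorff_dist K {orbit w \<sigma> x n | n. n \<ge> k}) \<longlonglongrightarrow> 0"
proof -
  interpret prob_space p by (rule prob)
  interpret product_prob_space "\<lambda>_::nat. p" UNIV ..
  have "\<exists>D::'l set. countable D \<and> closure D = UNIV"
    using sigma_compact_imp_countable_dense[of "\<lambda>_. UNIV"] compact_params by (simp add: top.extremum_unique)
  moreover have "\<exists>D::'x set. countable D \<and> closure D = UNIV"
  proof -
    have "(\<Union>n. cball x (real n)) = UNIV" by (auto intro: real_arch_simple)
    then show ?thesis
      using sigma_compact_imp_countable_dense[of "\<lambda>n. cball x (real n)"] proper
      by (simp add: top.extremum_unique)
  qed
  ultimately interpret random_ifs p w
    by unfold_locales (use borel cont in auto)
  let ?S = "\<Pi>\<^sub>M i\<in>UNIV::nat set. p"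
  have K: "compact K"
    and lim: "(\<lambda>n. hausdorff_dist ((hutchinson w ^^ n) {y}) K) \<longlonglongrightarrow> 0" for y
    using attractor by (auto simp: global_attractor_def)
  have pos: "measure p (ball l \<delta>) > 0" if \<delta>: "\<delta> > 0" for l \<delta>
  proof -
    from fair obtain f :: "real \<Rightarrow> real" where "f ` {0<..} \<subseteq> {0<..1}" "measure p (ball l \<delta>) \<ge> f \<delta>"
      unfolding fair_measure_def using \<delta> by blast
    moreover have "0 < f \<delta>" using calculation(1) \<delta> by auto
    ultimately show ?thesis by linarith
  qed
  define Y where "Y = (\<Union>n. (hutchinson w ^^ n) {x})"
  have xY: "x \<in> Y" unfolding Y_def by (rule UN_I[of 0]) auto
  have inv: "w (l, y) \<in> Y" if "y \<in> Y" for l y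
  proof -
    from that obtain n where "y \<in> (hutchinson w ^^ n) {x}" unfolding Y_def by blast
    then have "w (l, y) \<in> (hutchinson w ^^ Suc n) {x}" by (auto simp: hutchinson_def)
    then show ?thesis unfolding Y_def by blast
  qed
  have compact_Y: "compact (closure Y)"
  proof -
    have "bounded Y"
      unfolding Y_def by (rule bounded_reachable_set[OF compact_params cont attractor])
    then obtain a r where "closure Y \<subseteq> cball a r"
      by (meson bounded_closure bounded_subset_cball)
    then show ?thesis
      using compact_Int_closed[OF proper closed_closure, of a r Y] by (simp add: Int_absorb1)
  qed
  have reach: "\<exists>n. (hutchinson w ^^ n) {y} \<inter> ball a e \<noteq> {}" if "a \<in> K" "e > 0" for a e y
  proof -
    from eventually_infdist_less[OF lim \<open>e > 0\<close>, of y] \<open>a \<in> K\<close> obtain n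
      where "infdist a ((hutchinson w ^^ n) {y}) < e"
      by (auto simp: eventually_sequentially)
    moreover have "(hutchinson w ^^ n) {y} \<noteq> {}"
      using run_in_hutchinson_funpow[of w undefined y n] by blast
    ultimately obtain z where "z \<in> (hutchinson w ^^ n) {y}" "dist a z < e"
      by (rule infdist_lessE)
    then show ?thesis by (intro exI[of _ n]) auto
  qed
  have rec: "AE \<omega> in ?S. \<forall>N. \<exists>k\<ge>N. run w \<omega> x k \<in> ball a e" if a: "a \<in> K" and e: "e > 0" for a e
  proof -
    obtain q where "q > 0" "\<And>y. y \<in> closure Y \<Longrightarrow> \<exists>n. q \<le> measure ?S {\<omega>. run w \<omega> y n \<in> ball a e}"
      using uniform_hit[OF pos open_ball compact_Y reach[OF a e]] by metis
    then show ?thesis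
      using closure_subset[of Y] by (intro AE_run_recurrent[OF _ inv _ _ xY, of _ q]) auto
  qed
  have "\<exists>D. countable D \<and> D \<subseteq> K \<and> K \<subseteq> closure D"
    using sigma_compact_imp_countable_dense[of "\<lambda>_. K"] K by simp
  then obtain D where D: "countable D" "D \<subseteq> K" "K \<subseteq> closure D" by blast
  have "AE \<omega> in ?S. \<forall>d\<in>D. \<forall>i::nat. \<forall>N. \<exists>k\<ge>N. run w \<omega> x k \<in> ball d (1 / Suc i)"
  proof (subst AE_ball_countable[OF D(1)], rule ballI)
    fix d assume "d \<in> D"
    with D(2) rec have "AE \<omega> in ?S. \<forall>N. \<exists>k\<ge>N. run w \<omega> x k \<in> ball d (1 / Suc i)" for i :: nat
      by auto
    then show "AE \<omega> in ?S. \<forall>i::nat. \<forall>N. \<exists>k\<ge>N. run w \<omega> x k \<in> ball d (1 / Suc i)"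
      unfolding AE_all_countable by blast
  qed
  then have "AE \<omega> in ?S. (\<lambda>k. hausdorff_dist K {run w \<omega> x n | n. n \<ge> k}) \<longlonglongrightarrow> 0"
  proof eventually_elim
    case (elim \<omega>)
    show ?case
    proof (rule tendsto_hausdorff_tails[OF _ D(3)])
      fix e :: real assume "e > 0"
      from eventually_infdist_less[OF lim this, of x]
      show "eventually (\<lambda>n. infdist (run w \<omega> x n) K \<le> e) sequentially"
        by eventually_elim (use run_in_hutchinson_funpow[of w \<omega> x] in \<open>auto intro: less_imp_le\<close>)
    qed (use elim in blast)
  qed
  \<comment> \<open>Shifting the indices by one maps the given product measure onto the one indexed from 0.\<close>
  moreover have "?S = distr (\<Pi>\<^sub>M i\<in>{1::nat..}. p) ?S (\<lambda>\<sigma>. \<lambda>n\<in>UNIV. \<sigma> (Suc n))"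
    by (rule distr_PiM_reindex[symmetric, of _ "\<lambda>_. p" Suc UNIV]) (auto simp: prob)
  ultimately have "AE \<omega> in distr (\<Pi>\<^sub>M i\<in>{1::nat..}. p) ?S (\<lambda>\<sigma>. \<lambda>n\<in>UNIV. \<sigma> (Suc n)).
      (\<lambda>k. hausdorff_dist K {run w \<omega> x n | n. n \<ge> k}) \<longlonglongrightarrow> 0"
    by metis
  from AE_distrD[OF _ this]
  have "AE \<sigma> in (\<Pi>\<^sub>M i\<in>{1::nat..}. p).
      (\<lambda>k. hausdorff_dist K {run w (\<lambda>n\<in>UNIV. \<sigma> (Suc n)) x n | n. n \<ge> k}) \<longlonglongrightarrow> 0"
    by (simp add: measurable_restrict)
  then show ?thesis
    by (simp add: orbit_eq_run restrict_UNIV)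
qed

end
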